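(* Let $X$ be a set, let $F=E(\mathcal{J}_X)\subseteq\mathcal{P}_X$, let $\nabla=X\times X$, and let $\zeta=\{X,X'\}$ be the (unique) partition from $\mathcal{P}_X$ with $\mathrm{dom}(\zeta)=\mathrm{codom}(\zeta)=\varnothing$ and $\ker(\zeta)=\mathrm{coker}(\zeta)=\nabla$. With respect to the semilattice $F$: (i) $\mathrm{Rest}_R(\mathcal{P}_X,F)=\{\alpha\in\mathcal{P}_X:\mathrm{dom}(\alpha)=X\text{ or }\ker(\alpha)=\nabla\}=\{\alpha\in\mathcal{P}_X:\mathrm{dom}(\alpha)=X\}\sqcup\{\alpha\in\mathcal{P}_X:\mathrm{dom}(\alpha)=\varnothing,\ \ker(\alpha)=\nabla\}$; (ii) $\mathrm{Rest}_L(\mathcal{P}_X,F)=\{\alpha\in\mathcal{P}_X:\mathrm{codom}(\alpha)=X\text{ or }\mathrm{coker}(\alpha)=\nabla\}=\{\alpha\in\mathcal{P}_X:\mathrm{codom}(\alpha)=X\}\sqcup\{\alpha\in\mathcal{P}_X:\mathrm{codom}(\alpha)=\varnothing,\ \mathrm{coker}(\alpha)=\nabla\}$; (iii) $\mathrm{Rest}(\mathcal{P}_X,F)=\mathcal{J}_X\cup\{\zeta\}$ is the dual symmetric inverse monoid $\mathcal{J}_X$ with an additional zero $\zeta$ attached. Here $\sqcup$ denotes disjoint union.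
   Context: Partition monoid: let $X$ be a set and $X'=\{x':x\in X\}$ a disjoint copy of $X$. $\mathcal{P}_X$ is the set of all set partitions of $X\cup X'$. Given $\alpha,\beta\in\mathcal{P}_X$, let $X''=\{x'':x\in X\}$ be another disjoint copy; represent $\alpha$ and $\beta$ by graphs on $X\cup X'$ whose connected components are the blocks; rename each lower vertex $x'$ of $\alpha$ to $x''$ and each upper vertex $x$ of $\beta$ to $x''$; take the union of these graphs on $X\cup X''\cup X'$. The product $\alpha\beta$ is the partition of $X\cup X'$ in which two elements lie in the same block iff they are joined by a path in this union graph. This makes $\mathcal{P}_X$ a monoid. A block is a transversal if it meets both $X$ and $X'$. $\mathrm{dom}(\alpha)$ (resp. $\mathrm{codom}(\alpha)$) is the set of $x\in X$ such that $x$ (resp. $x'$) belongs to a transversal of $\alpha$. $\ker(\alpha)$ (resp. $\mathrm{coker}(\alpha)$) is the equivalence on $X$ of all $(x,y)$ with $x,y$ (resp. $x',y'$) in the same block of $\alpha$. The dual symmetric inverse monoid is $\mathcal{J}_X=\{\alpha\in\mathcal{P}_X:\mathrm{dom}(\alpha)=\mathrm{codom}(\alpha)=X\}$. For an equivalence $\varepsilon$ on $X$, $\mathrm{id}_\varepsilon=\{A\cup A':A\in X/\varepsilon\}$; $F=E(\mathcal{J}_X)=\{\mathrm{id}_\varepsilon:\varepsilon\text{ an equivalence on }X\}$ is the semilattice of idempotents of $\mathcal{J}_X$. For a semigroup $S$ and a semilattice $E\subseteq S$ of idempotents, say $x\,\mathscr{R}^E\,y$ (resp. $x\,\mathscr{L}^E\,y$)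 if $x$ and $y$ have the same left (resp. right) identities from $E$. $S$ is $E$-Ehresmann if every $\mathscr{R}^E$-class and every $\mathscr{L}^E$-class contains precisely one element of $E$, $\mathscr{R}^E$ is a left congruence and $\mathscr{L}^E$ is a right congruence. $\mathcal{P}_X$ is $F$-Ehresmann. For an $E$-Ehresmann semigroup $S$, define $\mathrm{Rest}_L(S,E)=\{x\in S:xE\subseteq Ex\}$, $\mathrm{Rest}_R(S,E)=\{x\in S:Ex\subseteq xE\}$, $\mathrm{Rest}(S,E)=\{x\in S:xE=Ex\}$. These are, respectively, the largest left-, right- and two-sided restriction subsemigroups of $S$ (with respect to $E$), where an $E$-Ehresmann semigroup $T$ is left-restriction if $xE\subseteq Ex$ for all $x\in T$, right-restriction if $Ex\subseteq xE$ for all $x\in T$, and restriction if both hold. *)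

theory Defs
  imports "HOL-Algebra.Coset" "HOL-Library.Disjoint_Sets"
begin

text \<open>
  The set \<open>X \<union> X'\<close> is rendered as the disjoint sum \<open>X <+> X\<close>: the upper vertex \<open>x\<close> is \<open>Inl x\<close>
  and the lower vertex \<open>x'\<close> is \<open>Inr x\<close>.  A partition is the set of its blocks.
\<close>

definition partitions :: "'a set \<Rightarrow> ('a + 'a) set set set" where
  "partitions X = {\<alpha>. partition_on (X <+> X) \<alpha>}"

datatype 'a vertex = Upper 'a | Middle 'a | Lower 'a

text \<open>
  Each block is represented by the complete graph (with loops) on it, the canonical choice of a
  graph whose connected components are the blocks.  The edge relation below is symmetric, so
  its reflexive transitive closure is "joined by a path".
\<close>

definition block_edges :: "('a + 'a) set set \<Rightarrow> (('a + 'a) \<times> ('a + 'a)) set" where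
  "block_edges \<alpha> = {(p, q). \<exists>A\<in>\<alpha>. p \<in> A \<and> q \<in> A}"

definition product_graph ::
  "('a + 'a) set set \<Rightarrow> ('a + 'a) set set \<Rightarrow> ('a vertex \<times> 'a vertex) set" where
  "product_graph \<alpha> \<beta> =
     map_prod (case_sum Upper Middle) (case_sum Upper Middle) ` block_edges \<alpha> \<union>
     map_prod (case_sum Middle Lower) (case_sum Middle Lower) ` block_edges \<beta>"

definition partition_product ::
  "'a set \<Rightarrow> ('a + 'a) set set \<Rightarrow> ('a + 'a) set set \<Rightarrow> ('a + 'a) set set" where
  "partition_product X \<alpha> \<beta> =
     (X <+> X) // {(p, q). p \<in> X <+> X \<and> q \<in> X <+> X \<and>
        (case_sum Upper Lower p, case_sum Upper Lower q) \<in> (product_graph \<alpha> \<beta>)\<^sup>*}"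

definition partition_monoid :: "'a set \<Rightarrow> ('a + 'a) set set monoid" where
  "partition_monoid X =
     \<lparr>carrier = partitions X, mult = partition_product X, one = (\<lambda>x. {Inl x, Inr x}) ` X\<rparr>"

definition transversal :: "'a set \<Rightarrow> ('a + 'a) set \<Rightarrow> bool" where
  "transversal X A \<longleftrightarrow> A \<inter> Inl ` X \<noteq> {} \<and> A \<inter> Inr ` X \<noteq> {}"

definition pdom :: "'a set \<Rightarrow> ('a + 'a) set set \<Rightarrow> 'a set" where
  "pdom X \<alpha> = {x \<in> X. \<exists>A\<in>\<alpha>. transversal X A \<and> Inl x \<in> A}"

definition pcodom :: "'a set \<Rightarrow> ('a + 'a) set set \<Rightarrow> 'a set" where
  "pcodom X \<alpha> = {x \<in> X. \<exists>A\<in>\<alpha>. transversal X A \<and> Inr x \<in> A}"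

definition pker :: "'a set \<Rightarrow> ('a + 'a) set set \<Rightarrow> ('a \<times> 'a) set" where
  "pker X \<alpha> = {(x, y). x \<in> X \<and> y \<in> X \<and> (\<exists>A\<in>\<alpha>. Inl x \<in> A \<and> Inl y \<in> A)}"

definition pcoker :: "'a set \<Rightarrow> ('a + 'a) set set \<Rightarrow> ('a \<times> 'a) set" where
  "pcoker X \<alpha> = {(x, y). x \<in> X \<and> y \<in> X \<and> (\<exists>A\<in>\<alpha>. Inr x \<in> A \<and> Inr y \<in> A)}"

definition dual_sym_inv :: "'a set \<Rightarrow> ('a + 'a) set set set" where
  "dual_sym_inv X = {\<alpha> \<in> partitions X. pdom X \<alpha> = X \<and> pcodom X \<alpha> = X}"

definition idempotents :: "('b, 'c) monoid_scheme \<Rightarrow> 'b set \<Rightarrow> 'b set" where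
  "idempotents S T = {e \<in> T. e \<otimes>\<^bsub>S\<^esub> e = e}"

definition dual_sym_inv_idems :: "'a set \<Rightarrow> ('a + 'a) set set set" where
  "dual_sym_inv_idems X = idempotents (partition_monoid X) (dual_sym_inv X)"

text \<open>
  The empty set is removed so that, when \<open>X\<close> is empty, the result is still a partition
  (the empty one); for nonempty \<open>X\<close> this is just \<open>{X, X'}\<close>.
\<close>

definition zeta :: "'a set \<Rightarrow> ('a + 'a) set set" where
  "zeta X = {Inl ` X, Inr ` X} - {{}}"

text \<open>Here \<open>x <#\<^bsub>S\<^esub> E\<close> and \<open>E #>\<^bsub>S\<^esub> x\<close> are the products \<open>xE\<close> and \<open>Ex\<close>.\<close>

definition Rest_L :: "('b, 'c) monoid_scheme \<Rightarrow> 'b set \<Rightarrow> 'b set" where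
  "Rest_L S E = {x \<in> carrier S. x <#\<^bsub>S\<^esub> E \<subseteq> E #>\<^bsub>S\<^esub> x}"

definition Rest_R :: "('b, 'c) monoid_scheme \<Rightarrow> 'b set \<Rightarrow> 'b set" where
  "Rest_R S E = {x \<in> carrier S. E #>\<^bsub>S\<^esub> x \<subseteq> x <#\<^bsub>S\<^esub> E}"

definition Rest :: "('b, 'c) monoid_scheme \<Rightarrow> 'b set \<Rightarrow> 'b set" where
  "Rest S E = {x \<in> carrier S. x <#\<^bsub>S\<^esub> E = E #>\<^bsub>S\<^esub> x}"

definition is_zero_on :: "('b, 'c) monoid_scheme \<Rightarrow> 'b set \<Rightarrow> 'b \<Rightarrow> bool" where
  "is_zero_on S T z \<longleftrightarrow> z \<in> T \<and> (\<forall>x\<in>T. x \<otimes>\<^bsub>S\<^esub> z = z \<and> z \<otimes>\<^bsub>S\<^esub> x = z)"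

end

theory Submission
  imports Defs
begin

text \<open>
  A partition \<open>\<alpha>\<close> is identified with the equivalence \<open>R = block_edges \<alpha>\<close> on \<open>X <+> X\<close>.  The
  idempotents of the dual symmetric inverse monoid are the partitions \<open>id\<^sub>\<epsilon>\<close>
  (\<open>dual_sym_inv_idems_eq\<close>), and multiplying by one of them is a join of equivalences:
  \<open>id\<^sub>\<epsilon> \<alpha>\<close> is the join of \<open>R\<close> with a copy of \<open>\<epsilon>\<close> on the upper vertices
  (\<open>path_rel_id_partition_left\<close>), and \<open>\<alpha> id\<^sub>\<eta>\<close> is the join of \<open>R\<close> with a copy of \<open>\<eta>\<close> on the
  lower vertices (\<open>path_rel_id_partition_right\<close>).

  Hence \<open>F \<alpha> \<subseteq> \<alpha> F\<close> says that whatever can be glued to \<open>R\<close> by an equivalence of the upper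
  vertices can also be glued by one of the lower vertices; \<open>\<alpha> F \<subseteq> F \<alpha>\<close> says the converse.  This is
  decided by \<open>join_exchange_iff\<close>.  If every upper vertex is in a transversal, then any gluing of
  upper vertices can be carried along transversals to the lower row.  If all upper vertices already
  form one class, there is nothing to glue.  Otherwise some upper block \<open>B\<close> is not a transversal
  and is not the whole upper row; gluing all upper vertices together enlarges \<open>B\<close>, which no gluing
  of lower vertices can do.  The same lemma with the two rows exchanged yields the left-right dual.

  A partition satisfying both conditions either has only transversals, or has none and is then
  \<open>zeta X\<close>, because a partition has an upper vertex in a transversal exactly when it has a lower one.
\<close>

section \<open>Paths, equivalences and joins\<close>

lemma rtrancl_image:
  assumes "(a, b) \<in> r\<^sup>*" and "\<And>u v. (u, v) \<in> r \<Longrightarrow> (f u, f v) \<in> s\<^sup>*"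
  shows "(f a, f b) \<in> s\<^sup>*"
  using assms(1) by (induction rule: rtrancl_induct) (auto intro: rtrancl_trans assms(2))

lemma rtrancl_invariant:
  assumes "(a, b) \<in> r\<^sup>*" and "a \<in> U" and "r `` U \<subseteq> U"
  shows "b \<in> U"
  using assms by (induction rule: rtrancl_induct) auto

lemma equivI':
  assumes "r \<subseteq> A \<times> A" and "\<And>x. x \<in> A \<Longrightarrow> (x, x) \<in> r"
    and "\<And>x y. (x, y) \<in> r \<Longrightarrow> (y, x) \<in> r"
    and "\<And>x y z. (x, y) \<in> r \<Longrightarrow> (y, z) \<in> r \<Longrightarrow> (x, z) \<in> r"
  shows "equiv A r"
  using assms unfolding equiv_def refl_on_def sym_def trans_def by blast

lemma equivD:
  assumes "equiv A r"
  shows "(x, y) \<in> r \<Longrightarrow> x \<in> A" and "(x, y) \<in> r \<Longrightarrow> y \<in> A"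
    and "x \<in> A \<Longrightarrow> (x, x) \<in> r"
    and "(x, y) \<in> r \<Longrightarrow> (y, x) \<in> r"
    and "(x, y) \<in> r \<Longrightarrow> (y, z) \<in> r \<Longrightarrow> (x, z) \<in> r"
  using assms unfolding equiv_def refl_on_def sym_def trans_def by blast+

lemma equiv_join:
  assumes R: "equiv A R" and S: "equiv B S" and "B \<subseteq> A"
  shows "equiv A ((R \<union> S)\<^sup>+)"
proof (rule equivI)
  have RS: "R \<union> S \<subseteq> A \<times> A"
    using equivD(1,2)[OF R] equivD(1,2)[OF S] \<open>B \<subseteq> A\<close> by fast
  then show "(R \<union> S)\<^sup>+ \<subseteq> A \<times> A"
    by (rule trancl_subset_Sigma)
  show "refl_on A ((R \<union> S)\<^sup>+)"
    using equivD(3)[OF R] by (auto simp: refl_on_def)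
  have "sym (R \<union> S)"
    using R S by (auto simp: equiv_def intro: sym_Un)
  then show "sym ((R \<union> S)\<^sup>+)" by (rule sym_trancl)
qed (rule trans_trancl)

text \<open>For equivalences \<open>R\<close> and \<open>S\<close> the closure \<open>(R \<union> S)\<^sup>+\<close> is their join; this is its universal property.\<close>

lemma join_subset_iff:
  assumes "equiv A Q" and "R \<subseteq> Q"
  shows "(R \<union> S)\<^sup>+ \<subseteq> Q \<longleftrightarrow> S \<subseteq> Q"
proof
  assume "(R \<union> S)\<^sup>+ \<subseteq> Q" then show "S \<subseteq> Q" by auto
next
  assume "S \<subseteq> Q"
  then have "(R \<union> S)\<^sup>+ \<subseteq> Q\<^sup>+" using \<open>R \<subseteq> Q\<close> by (intro trancl_mono_subset) auto
  also have "Q\<^sup>+ = Q" using assms(1) by (simp add: equiv_def)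
  finally show "(R \<union> S)\<^sup>+ \<subseteq> Q" .
qed

lemma join_absorb:
  assumes "equiv A R" and "S \<subseteq> R"
  shows "(R \<union> S)\<^sup>+ = R"
  using assms by (simp add: Un_absorb2 equiv_def)

text \<open>
  The combinatorial core.  The sets \<open>A\<close> and \<open>B\<close> stand for the two rows of vertices, in either order,
  so that the right and the left version of the main result are both instances.
  Testing the left-hand side on \<open>\<epsilon> = A \<times> A\<close> is enough for the forward direction: the \<open>R\<close>-class of
  an element of \<open>A\<close> that misses \<open>B\<close> is not affected by joining with an equivalence on \<open>B\<close>.
  Conversely, a suitable \<open>\<eta>\<close> is the trace on \<open>B\<close> of the join of \<open>R\<close> and \<open>\<epsilon>\<close>.
\<close>

lemma join_exchange_iff:
  assumes R: "equiv (A \<union> B) R" and disj: "A \<inter> B = {}"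
  shows "(\<forall>\<epsilon>. equiv A \<epsilon> \<longrightarrow> (\<exists>\<eta>. equiv B \<eta> \<and> (R \<union> \<epsilon>)\<^sup>+ = (R \<union> \<eta>)\<^sup>+)) \<longleftrightarrow>
         (\<forall>a\<in>A. \<exists>b\<in>B. (a, b) \<in> R) \<or> A \<times> A \<subseteq> R"
    (is "?exchange \<longleftrightarrow> _")
proof
  assume exch: ?exchange
  have "equiv A (A \<times> A)" by (rule equivI') auto
  with exch obtain \<eta> where \<eta>: "equiv B \<eta>" and eq: "(R \<union> A \<times> A)\<^sup>+ = (R \<union> \<eta>)\<^sup>+" by blast
  show "(\<forall>a\<in>A. \<exists>b\<in>B. (a, b) \<in> R) \<or> A \<times> A \<subseteq> R"
  proof (rule disjCI)
    assume "\<not> A \<times> A \<subseteq> R"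
    show "\<forall>a\<in>A. \<exists>b\<in>B. (a, b) \<in> R"
    proof (rule ccontr)
      assume "\<not> (\<forall>a\<in>A. \<exists>b\<in>B. (a, b) \<in> R)"
      then obtain a where a: "a \<in> A" "\<And>b. b \<in> B \<Longrightarrow> (a, b) \<notin> R" by blast
      \<comment> \<open>The class of \<open>a\<close> contains no element of \<open>B\<close>, so edges of \<open>\<eta>\<close> cannot leave it.\<close>
      have closed: "(R \<union> \<eta>) `` (R `` {a}) \<subseteq> R `` {a}"
        using a(2) equivD(1)[OF \<eta>] equivD(5)[OF R] by blast
      have "(a, c) \<in> R" if "c \<in> A" for c
      proof -
        have "(a, c) \<in> (R \<union> \<eta>)\<^sup>+" using a(1) that by (auto simp flip: eq)
        then have "(a, c) \<in> (R \<union> \<eta>)\<^sup>*" by (rule trancl_into_rtrancl)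
        then have "c \<in> R `` {a}"
          by (rule rtrancl_invariant) (use closed a(1) equivD(3)[OF R] in auto)
        then show ?thesis by simp
      qed
      then have "A \<times> A \<subseteq> R" using equivD(4,5)[OF R] by blast
      with \<open>\<not> A \<times> A \<subseteq> R\<close> show False ..
    qed
  qed
next
  assume "(\<forall>a\<in>A. \<exists>b\<in>B. (a, b) \<in> R) \<or> A \<times> A \<subseteq> R"
  then show ?exchange
  proof (elim disjE; intro allI impI)
    fix \<epsilon> assume \<epsilon>: "equiv A \<epsilon>" and full: "\<forall>a\<in>A. \<exists>b\<in>B. (a, b) \<in> R"
    define Q where "Q = (R \<union> \<epsilon>)\<^sup>+"
    have Q: "equiv (A \<union> B) Q" and RQ: "R \<subseteq> Q" and \<epsilon>Q: "\<epsilon> \<subseteq> Q"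
      unfolding Q_def using equiv_join[OF R \<epsilon>] by auto
    define \<eta> where "\<eta> = Q \<inter> B \<times> B"
    have \<eta>: "equiv B \<eta>"
      unfolding \<eta>_def by (rule equivI') (use equivD[OF Q] in blast)+
    have Q': "equiv (A \<union> B) ((R \<union> \<eta>)\<^sup>+)" using equiv_join[OF R \<eta>] by simp
    \<comment> \<open>Each \<open>\<epsilon>\<close>-edge is replaced by the detour \<open>a - b - d - c\<close> through \<open>B\<close>.\<close>
    have "\<epsilon> \<subseteq> (R \<union> \<eta>)\<^sup>+"
    proof (rule subrelI)
      fix a c assume ac: "(a, c) \<in> \<epsilon>"
      then obtain b d where bd: "b \<in> B" "(a, b) \<in> R" "d \<in> B" "(c, d) \<in> R"
        using full equivD(1,2)[OF \<epsilon>] by meson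
      have "(b, d) \<in> Q"
        using ac bd RQ \<epsilon>Q equivD(4,5)[OF Q] by blast
      then have "(b, d) \<in> \<eta>" using bd by (simp add: \<eta>_def)
      then have "(a, b) \<in> (R \<union> \<eta>)\<^sup>+" "(b, d) \<in> (R \<union> \<eta>)\<^sup>+" "(c, d) \<in> (R \<union> \<eta>)\<^sup>+"
        using bd by auto
      then show "(a, c) \<in> (R \<union> \<eta>)\<^sup>+" using equivD(4,5)[OF Q'] by meson
    qed
    then have "Q \<subseteq> (R \<union> \<eta>)\<^sup>+"
      unfolding Q_def by (subst join_subset_iff[OF Q']) auto
    moreover have "(R \<union> \<eta>)\<^sup>+ \<subseteq> Q"
      by (subst join_subset_iff[OF Q RQ]) (simp add: \<eta>_def)
    ultimately show "\<exists>\<eta>. equiv B \<eta> \<and> (R \<union> \<epsilon>)\<^sup>+ = (R \<union> \<eta>)\<^sup>+"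
      using \<eta> unfolding Q_def by blast
  next
    fix \<epsilon> assume \<epsilon>: "equiv A \<epsilon>" and "A \<times> A \<subseteq> R"
    then have "(R \<union> \<epsilon>)\<^sup>+ = R"
      using equiv_type[OF \<epsilon>] by (intro join_absorb[OF R]) blast
    moreover have "(R \<union> Id_on B)\<^sup>+ = R"
      using equivD(3)[OF R] by (intro join_absorb[OF R]) blast
    moreover have "equiv B (Id_on B)" by (rule equivI') auto
    ultimately show "\<exists>\<eta>. equiv B \<eta> \<and> (R \<union> \<epsilon>)\<^sup>+ = (R \<union> \<eta>)\<^sup>+" by blast
  qed
qed

text \<open>This turns quantification over equivalences on one row of vertices into quantification over equivalences on \<open>X\<close>.\<close>

lemma equivs_on_inj_image:
  assumes "inj f"
  shows "{\<rho>. equiv (f ` X) \<rho>} = (\<lambda>\<epsilon>. map_prod f f ` \<epsilon>) ` {\<epsilon>. equiv X \<epsilon>}"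
proof (intro subset_antisym subsetI)
  fix \<rho> assume "\<rho> \<in> {\<rho>. equiv (f ` X) \<rho>}"
  then have \<rho>: "equiv (f ` X) \<rho>" by simp
  define \<epsilon> where "\<epsilon> = {(x, y). x \<in> X \<and> y \<in> X \<and> (f x, f y) \<in> \<rho>}"
  have "equiv X \<epsilon>"
  proof (rule equivI')
    show "(x, z) \<in> \<epsilon>" if "(x, y) \<in> \<epsilon>" "(y, z) \<in> \<epsilon>" for x y z
      using that equivD(5)[OF \<rho>, of "f x" "f y" "f z"] by (simp add: \<epsilon>_def)
  qed (auto simp: \<epsilon>_def intro: equivD(3,4)[OF \<rho>])
  moreover have "\<rho> = map_prod f f ` \<epsilon>"
  proof (intro subset_antisym subrelI)
    fix p q assume "(p, q) \<in> \<rho>"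
    moreover from this obtain x y where "x \<in> X" "p = f x" "y \<in> X" "q = f y"
      using equivD(1,2)[OF \<rho>] by (meson imageE)
    ultimately show "(p, q) \<in> map_prod f f ` \<epsilon>" by (auto simp: \<epsilon>_def)
  qed (auto simp: \<epsilon>_def)
  ultimately show "\<rho> \<in> (\<lambda>\<epsilon>. map_prod f f ` \<epsilon>) ` {\<epsilon>. equiv X \<epsilon>}" by blast
next
  fix \<rho> assume "\<rho> \<in> (\<lambda>\<epsilon>. map_prod f f ` \<epsilon>) ` {\<epsilon>. equiv X \<epsilon>}"
  then obtain \<epsilon> where \<epsilon>: "equiv X \<epsilon>" and \<rho>: "\<rho> = map_prod f f ` \<epsilon>" by blast
  have "equiv (f ` X) \<rho>"
  proof (rule equivI')
    show "\<rho> \<subseteq> f ` X \<times> f ` X" using equiv_type[OF \<epsilon>] by (auto simp: \<rho>)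
    show "(p, p) \<in> \<rho>" if "p \<in> f ` X" for p
    proof -
      from that obtain x where "x \<in> X" "p = f x" by blast
      then show ?thesis using equivD(3)[OF \<epsilon>, of x] by (force simp: \<rho>)
    qed
    show "(q, p) \<in> \<rho>" if "(p, q) \<in> \<rho>" for p q
    proof -
      from that obtain x y where "(x, y) \<in> \<epsilon>" "p = f x" "q = f y" by (auto simp: \<rho>)
      then show ?thesis using equivD(4)[OF \<epsilon>, of x y] by (force simp: \<rho>)
    qed
    show "(p, r) \<in> \<rho>" if "(p, q) \<in> \<rho>" "(q, r) \<in> \<rho>" for p q r
    proof -
      from that obtain x y y' z where "(x, y) \<in> \<epsilon>" "(y', z) \<in> \<epsilon>" "f y = f y'" "p = f x" "r = f z"
        by (auto simp: \<rho>)
      then show ?thesis using equivD(5)[OF \<epsilon>, of x y z] injD[OF assms, of y y'] by (force simp: \<rho>)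
    qed
  qed
  then show "\<rho> \<in> {\<rho>. equiv (f ` X) \<rho>}" by simp
qed

section \<open>Partitions as equivalence relations\<close>

lemma equiv_block_edges:
  assumes "\<alpha> \<in> partitions X"
  shows "equiv (X <+> X) (block_edges \<alpha>)"
  using equiv_partition_on[of "X <+> X" \<alpha>] assms by (simp add: partitions_def block_edges_def)

lemma quotient_block_edges:
  assumes "\<alpha> \<in> partitions X"
  shows "(X <+> X) // block_edges \<alpha> = \<alpha>"
  using partition_on_eq_quotient[of "X <+> X" \<alpha>] assms by (simp add: partitions_def block_edges_def)

lemma quotient_in_partitions:
  assumes "equiv (X <+> X) Q"
  shows "(X <+> X) // Q \<in> partitions X"
  using partition_on_quotient[OF assms] by (simp add: partitions_def)

lemma block_edges_quotient:
  assumes "equiv (X <+> X) Q"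
  shows "block_edges ((X <+> X) // Q) = Q"
proof (intro subset_antisym subrelI)
  fix p q assume "(p, q) \<in> block_edges ((X <+> X) // Q)"
  then obtain c where "(c, p) \<in> Q" "(c, q) \<in> Q"
    by (auto simp: block_edges_def quotient_def)
  then show "(p, q) \<in> Q" using equivD(4,5)[OF assms] by meson
next
  fix p q assume "(p, q) \<in> Q"
  then have "Q `` {p} \<in> (X <+> X) // Q" "p \<in> Q `` {p}" "q \<in> Q `` {p}"
    using equivD(1,3)[OF assms] by (auto intro: quotientI)
  then show "(p, q) \<in> block_edges ((X <+> X) // Q)" by (auto simp: block_edges_def)
qed

lemma partition_eqI:
  assumes "\<alpha> \<in> partitions X" and "\<beta> \<in> partitions X" and "block_edges \<alpha> = block_edges \<beta>"
  shows "\<alpha> = \<beta>"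
  using assms quotient_block_edges by metis

lemma pdom_iff:
  "x \<in> pdom X \<alpha> \<longleftrightarrow> x \<in> X \<and> (\<exists>y\<in>X. (Inl x, Inr y) \<in> block_edges \<alpha>)"
  unfolding pdom_def transversal_def block_edges_def by blast

lemma pcodom_iff:
  "y \<in> pcodom X \<alpha> \<longleftrightarrow> y \<in> X \<and> (\<exists>x\<in>X. (Inl x, Inr y) \<in> block_edges \<alpha>)"
  unfolding pcodom_def transversal_def block_edges_def by blast

lemma pker_iff: "(x, y) \<in> pker X \<alpha> \<longleftrightarrow> x \<in> X \<and> y \<in> X \<and> (Inl x, Inl y) \<in> block_edges \<alpha>"
  unfolding pker_def block_edges_def by blast

lemma pcoker_iff: "(x, y) \<in> pcoker X \<alpha> \<longleftrightarrow> x \<in> X \<and> y \<in> X \<and> (Inr x, Inr y) \<in> block_edges \<alpha>"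
  unfolding pcoker_def block_edges_def by blast

section \<open>The product as a relation\<close>

definition path_rel :: "'a set \<Rightarrow> ('a + 'a) set set \<Rightarrow> ('a + 'a) set set \<Rightarrow> (('a + 'a) \<times> ('a + 'a)) set"
  where "path_rel X \<alpha> \<beta> =
    {(p, q). p \<in> X <+> X \<and> q \<in> X <+> X \<and>
       (case_sum Upper Lower p, case_sum Upper Lower q) \<in> (product_graph \<alpha> \<beta>)\<^sup>*}"

lemma sym_map_prod_image: "sym r \<Longrightarrow> sym (map_prod f f ` r)"
  by (force simp: sym_def)

lemma sym_product_graph: "sym (product_graph \<alpha> \<beta>)"
proof -
  have "sym (block_edges \<gamma>)" for \<gamma> :: "('a + 'a) set set"
    by (auto simp: sym_def block_edges_def)
  then show ?thesis by (simp add: product_graph_def sym_Un sym_map_prod_image)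
qed

lemma equiv_path_rel: "equiv (X <+> X) (path_rel X \<alpha> \<beta>)"
proof (rule equivI')
  fix p q assume "(p, q) \<in> path_rel X \<alpha> \<beta>"
  then show "(q, p) \<in> path_rel X \<alpha> \<beta>"
    by (auto simp: path_rel_def intro: symD[OF sym_rtrancl[OF sym_product_graph]])
next
  fix p q r assume "(p, q) \<in> path_rel X \<alpha> \<beta>" "(q, r) \<in> path_rel X \<alpha> \<beta>"
  then show "(p, r) \<in> path_rel X \<alpha> \<beta>" by (auto simp: path_rel_def)
qed (auto simp: path_rel_def)

lemma partition_product_eq_quotient: "partition_product X \<alpha> \<beta> = (X <+> X) // path_rel X \<alpha> \<beta>"
  by (simp add: partition_product_def path_rel_def)

lemma partition_product_in_partitions: "partition_product X \<alpha> \<beta> \<in> partitions X"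
  by (simp add: partition_product_eq_quotient quotient_in_partitions equiv_path_rel)

lemma block_edges_partition_product:
  "block_edges (partition_product X \<alpha> \<beta>) = path_rel X \<alpha> \<beta>"
  by (simp add: partition_product_eq_quotient block_edges_quotient equiv_path_rel)

lemma product_graph_left:
  assumes "(p, q) \<in> block_edges \<alpha>"
  shows "(case_sum Upper Middle p, case_sum Upper Middle q) \<in> product_graph \<alpha> \<beta>"
  using imageI[OF assms, of "map_prod (case_sum Upper Middle) (case_sum Upper Middle)"]
  unfolding product_graph_def by simp

lemma product_graph_right:
  assumes "(p, q) \<in> block_edges \<beta>"
  shows "(case_sum Middle Lower p, case_sum Middle Lower q) \<in> product_graph \<alpha> \<beta>"
  using imageI[OF assms, of "map_prod (case_sum Middle Lower) (case_sum Middle Lower)"]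
  unfolding product_graph_def by simp

lemma product_graph_cases:
  assumes "(u, v) \<in> product_graph \<alpha> \<beta>"
  obtains p q where "(p, q) \<in> block_edges \<alpha>" "u = case_sum Upper Middle p" "v = case_sum Upper Middle q"
  | p q where "(p, q) \<in> block_edges \<beta>" "u = case_sum Middle Lower p" "v = case_sum Middle Lower q"
  using assms unfolding product_graph_def by (elim UnE prod_fun_imageE) simp_all

section \<open>Multiplication by the partitions \<open>id\<^sub>\<epsilon>\<close>\<close>

definition id_partition :: "'a set \<Rightarrow> ('a \<times> 'a) set \<Rightarrow> ('a + 'a) set set" where
  "id_partition X \<epsilon> = (\<lambda>A. A <+> A) ` (X // \<epsilon>)"

text \<open>
  The map \<open>case_sum id id\<close> forgets in which row a vertex lies; the blocks of \<open>id\<^sub>\<epsilon>\<close> do not depend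
  on the row.
\<close>

lemma id_partition_props:
  assumes \<epsilon>: "equiv X \<epsilon>"
  shows id_partition_in_partitions: "id_partition X \<epsilon> \<in> partitions X"
    and block_edges_id_partition:
      "block_edges (id_partition X \<epsilon>) = {(p, q). (case_sum id id p, case_sum id id q) \<in> \<epsilon>}"
proof -
  define Q :: "(('a + 'a) \<times> ('a + 'a)) set"
    where "Q = {(p, q). (case_sum id id p, case_sum id id q) \<in> \<epsilon>}"
  have Q: "equiv (X <+> X) Q"
  proof (rule equivI')
    show "Q \<subseteq> (X <+> X) \<times> (X <+> X)"
    proof (rule subrelI)
      fix p q assume "(p, q) \<in> Q"
      then show "(p, q) \<in> (X <+> X) \<times> (X <+> X)"
        using equivD(1,2)[OF \<epsilon>, of "case_sum id id p" "case_sum id id q"]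
        by (cases p; cases q) (auto simp: Q_def)
    qed
    show "(p, r) \<in> Q" if "(p, q) \<in> Q" "(q, r) \<in> Q" for p q r
      using that equivD(5)[OF \<epsilon>] unfolding Q_def mem_Collect_eq case_prod_conv by blast
  qed (auto simp: Q_def intro: equivD(3,4)[OF \<epsilon>])
  have cls: "Q `` {p} = \<epsilon> `` {case_sum id id p} <+> \<epsilon> `` {case_sum id id p}" for p
  proof (rule Set.set_eqI)
    fix q show "q \<in> Q `` {p} \<longleftrightarrow> q \<in> \<epsilon> `` {case_sum id id p} <+> \<epsilon> `` {case_sum id id p}"
      by (cases q) (auto simp: Q_def)
  qed
  have "(X <+> X) // Q = id_partition X \<epsilon>"
    unfolding id_partition_def quotient_def cls by (auto simp: Plus_def[of X] image_iff)
  then show "id_partition X \<epsilon> \<in> partitions X"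
    and "block_edges (id_partition X \<epsilon>) = {(p, q). (case_sum id id p, case_sum id id q) \<in> \<epsilon>}"
    using quotient_in_partitions[OF Q] block_edges_quotient[OF Q] unfolding Q_def by auto
qed

text \<open>
  In the product graph of \<open>\<alpha>\<close> and \<open>id\<^sub>\<epsilon>\<close> every middle vertex \<open>x''\<close> is joined to the lower vertex
  \<open>x'\<close>.  Identifying these two rows therefore does not change reachability and turns the
  graph into the union of \<open>block_edges \<alpha>\<close> and a copy of \<open>\<epsilon>\<close> on the lower row.  The next lemma is
  the mirror image, where the middle row is identified with the upper one.
\<close>

lemma path_rel_id_partition_right:
  assumes \<alpha>: "\<alpha> \<in> partitions X" and \<epsilon>: "equiv X \<epsilon>"
  shows "path_rel X \<alpha> (id_partition X \<epsilon>) = (block_edges \<alpha> \<union> map_prod Inr Inr ` \<epsilon>)\<^sup>+"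
    (is "_ = ?J\<^sup>+")
proof (intro subset_antisym subrelI)
  note R = equiv_block_edges[OF \<alpha>]
  fix p q assume pq: "(p, q) \<in> path_rel X \<alpha> (id_partition X \<epsilon>)"
  \<comment> \<open>Collapse the middle row onto the lower row.\<close>
  define h :: "'a vertex \<Rightarrow> 'a + 'a" where "h = case_vertex Inl Inr Inr"
  have h: "h (case_sum Upper Middle p) = p" "h (case_sum Upper Lower p) = p"
    "h (case_sum Middle Lower p) = Inr (case_sum id id p)" for p
    by (auto simp: h_def split: sum.splits)
  have "(h (case_sum Upper Lower p), h (case_sum Upper Lower q)) \<in> ?J\<^sup>*"
  proof (rule rtrancl_image[where f = h])
    show "(case_sum Upper Lower p, case_sum Upper Lower q)
        \<in> (product_graph \<alpha> (id_partition X \<epsilon>))\<^sup>*"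
      using pq by (simp add: path_rel_def)
    fix u v assume "(u, v) \<in> product_graph \<alpha> (id_partition X \<epsilon>)"
    then show "(h u, h v) \<in> ?J\<^sup>*"
    proof (cases rule: product_graph_cases)
      case (2 p q)
      then have "(case_sum id id p, case_sum id id q) \<in> \<epsilon>"
        by (simp add: block_edges_id_partition[OF \<epsilon>])
      then have "(Inr (case_sum id id p), Inr (case_sum id id q)) \<in> ?J"
        by (intro UnI2 map_prod_imageI)
      then show ?thesis unfolding 2(2,3) h by (rule r_into_rtrancl)
    qed (auto simp: h)
  qed
  then have "(p, q) \<in> ?J\<^sup>*" by (simp add: h)
  moreover have "(p, p) \<in> ?J\<^sup>+" using pq equivD(3)[OF R] by (auto simp: path_rel_def)
  ultimately show "(p, q) \<in> ?J\<^sup>+" by (rule trancl_rtrancl_trancl[rotated])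
next
  note R = equiv_block_edges[OF \<alpha>]
  let ?G = "product_graph \<alpha> (id_partition X \<epsilon>)"
  fix p q assume pq: "(p, q) \<in> ?J\<^sup>+"
  have "?J \<subseteq> (X <+> X) \<times> (X <+> X)"
    using equivD(1,2)[OF R] equivD(1,2)[OF \<epsilon>] by auto
  from trancl_subset_Sigma[OF this] pq have X: "p \<in> X <+> X" "q \<in> X <+> X" by auto
  \<comment> \<open>The path is traced between the upper and the middle row; only its ends may have to move to the lower row.\<close>
  have inner: "(case_sum Upper Middle p, case_sum Upper Middle q) \<in> ?G\<^sup>*"
  proof (rule rtrancl_image[where f = "case_sum Upper Middle"])
    show "(p, q) \<in> ?J\<^sup>*" using pq by (rule trancl_into_rtrancl)
    fix u v assume "(u, v) \<in> ?J"
    then consider "(u, v) \<in> block_edges \<alpha>" | x y where "(x, y) \<in> \<epsilon>" "u = Inr x" "v = Inr y" by auto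
    then show "(case_sum Upper Middle u, case_sum Upper Middle v) \<in> ?G\<^sup>*"
    proof cases
      case 2
      then have "(Inl x, Inl y) \<in> block_edges (id_partition X \<epsilon>)"
        by (simp add: block_edges_id_partition[OF \<epsilon>])
      from product_graph_right[OF this, of \<alpha>] show ?thesis using 2 by auto
    qed (auto dest: product_graph_left)
  qed
  have ends: "(case_sum Upper Middle r, case_sum Upper Lower r) \<in> ?G\<^sup>*" if "r \<in> X <+> X" for r
  proof (cases r)
    case (Inr x)
    then have "(Inl x, Inr x) \<in> block_edges (id_partition X \<epsilon>)"
      using that equivD(3)[OF \<epsilon>] by (auto simp: block_edges_id_partition[OF \<epsilon>])
    from product_graph_right[OF this, of \<alpha>] show ?thesis using Inr by auto
  qed auto
  note symD[OF sym_rtrancl[OF sym_product_graph] ends[OF X(1)]]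
  also note inner
  also note ends[OF X(2)]
  finally show "(p, q) \<in> path_rel X \<alpha> (id_partition X \<epsilon>)"
    using X by (simp add: path_rel_def)
qed

lemma path_rel_id_partition_left:
  assumes \<alpha>: "\<alpha> \<in> partitions X" and \<epsilon>: "equiv X \<epsilon>"
  shows "path_rel X (id_partition X \<epsilon>) \<alpha> = (block_edges \<alpha> \<union> map_prod Inl Inl ` \<epsilon>)\<^sup>+"
    (is "_ = ?J\<^sup>+")
proof (intro subset_antisym subrelI)
  note R = equiv_block_edges[OF \<alpha>]
  fix p q assume pq: "(p, q) \<in> path_rel X (id_partition X \<epsilon>) \<alpha>"
  \<comment> \<open>Collapse the middle row onto the upper row.\<close>
  define h :: "'a vertex \<Rightarrow> 'a + 'a" where "h = case_vertex Inl Inl Inr"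
  have h: "h (case_sum Middle Lower p) = p" "h (case_sum Upper Lower p) = p"
    "h (case_sum Upper Middle p) = Inl (case_sum id id p)" for p
    by (auto simp: h_def split: sum.splits)
  have "(h (case_sum Upper Lower p), h (case_sum Upper Lower q)) \<in> ?J\<^sup>*"
  proof (rule rtrancl_image[where f = h])
    show "(case_sum Upper Lower p, case_sum Upper Lower q)
        \<in> (product_graph (id_partition X \<epsilon>) \<alpha>)\<^sup>*"
      using pq by (simp add: path_rel_def)
    fix u v assume "(u, v) \<in> product_graph (id_partition X \<epsilon>) \<alpha>"
    then show "(h u, h v) \<in> ?J\<^sup>*"
    proof (cases rule: product_graph_cases)
      case (1 p q)
      then have "(case_sum id id p, case_sum id id q) \<in> \<epsilon>"
        by (simp add: block_edges_id_partition[OF \<epsilon>])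
      then have "(Inl (case_sum id id p), Inl (case_sum id id q)) \<in> ?J"
        by (intro UnI2 map_prod_imageI)
      then show ?thesis unfolding 1(2,3) h by (rule r_into_rtrancl)
    qed (auto simp: h)
  qed
  then have "(p, q) \<in> ?J\<^sup>*" by (simp add: h)
  moreover have "(p, p) \<in> ?J\<^sup>+" using pq equivD(3)[OF R] by (auto simp: path_rel_def)
  ultimately show "(p, q) \<in> ?J\<^sup>+" by (rule trancl_rtrancl_trancl[rotated])
next
  note R = equiv_block_edges[OF \<alpha>]
  let ?G = "product_graph (id_partition X \<epsilon>) \<alpha>"
  fix p q assume pq: "(p, q) \<in> ?J\<^sup>+"
  have "?J \<subseteq> (X <+> X) \<times> (X <+> X)"
    using equivD(1,2)[OF R] equivD(1,2)[OF \<epsilon>] by auto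
  from trancl_subset_Sigma[OF this] pq have X: "p \<in> X <+> X" "q \<in> X <+> X" by auto
  \<comment> \<open>The path is traced between the middle and the lower row; only its ends may have to move to the upper row.\<close>
  have inner: "(case_sum Middle Lower p, case_sum Middle Lower q) \<in> ?G\<^sup>*"
  proof (rule rtrancl_image[where f = "case_sum Middle Lower"])
    show "(p, q) \<in> ?J\<^sup>*" using pq by (rule trancl_into_rtrancl)
    fix u v assume "(u, v) \<in> ?J"
    then consider "(u, v) \<in> block_edges \<alpha>" | x y where "(x, y) \<in> \<epsilon>" "u = Inl x" "v = Inl y" by auto
    then show "(case_sum Middle Lower u, case_sum Middle Lower v) \<in> ?G\<^sup>*"
    proof cases
      case 2
      then have "(Inr x, Inr y) \<in> block_edges (id_partition X \<epsilon>)"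
        by (simp add: block_edges_id_partition[OF \<epsilon>])
      from product_graph_left[OF this, of \<alpha>] show ?thesis using 2 by auto
    qed (auto dest: product_graph_right)
  qed
  have ends: "(case_sum Middle Lower r, case_sum Upper Lower r) \<in> ?G\<^sup>*" if "r \<in> X <+> X" for r
  proof (cases r)
    case (Inl x)
    then have "(Inr x, Inl x) \<in> block_edges (id_partition X \<epsilon>)"
      using that equivD(3)[OF \<epsilon>] by (auto simp: block_edges_id_partition[OF \<epsilon>])
    from product_graph_left[OF this, of \<alpha>] show ?thesis using Inl by auto
  qed auto
  note symD[OF sym_rtrancl[OF sym_product_graph] ends[OF X(1)]]
  also note inner
  also note ends[OF X(2)]
  finally show "(p, q) \<in> path_rel X (id_partition X \<epsilon>) \<alpha>"
    using X by (simp add: path_rel_def)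
qed

section \<open>The idempotents of the dual symmetric inverse monoid\<close>

lemma dual_sym_inv_iff:
  "\<alpha> \<in> dual_sym_inv X \<longleftrightarrow> \<alpha> \<in> partitions X \<and>
     (\<forall>x\<in>X. \<exists>y\<in>X. (Inl x, Inr y) \<in> block_edges \<alpha>) \<and> (\<forall>y\<in>X. \<exists>x\<in>X. (Inl x, Inr y) \<in> block_edges \<alpha>)"
  unfolding dual_sym_inv_def set_eq_iff pdom_iff pcodom_iff by auto

lemma path_rel_through_middle:
  assumes "(Inl x, Inr y) \<in> block_edges \<alpha>" and "(Inl y, Inr z) \<in> block_edges \<beta>"
    and "x \<in> X" and "z \<in> X"
  shows "(Inl x, Inr z) \<in> path_rel X \<alpha> \<beta>"
proof -
  have "(Upper x, Middle y) \<in> product_graph \<alpha> \<beta>" "(Middle y, Lower z) \<in> product_graph \<alpha> \<beta>"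
    using product_graph_left[OF assms(1), of \<beta>] product_graph_right[OF assms(2), of \<alpha>] by auto
  then show ?thesis using assms(3,4) by (auto simp: path_rel_def)
qed

lemma id_partition_in_dual_sym_inv:
  assumes "equiv X \<epsilon>"
  shows "id_partition X \<epsilon> \<in> dual_sym_inv X"
  using equivD(3)[OF assms]
  by (auto simp: dual_sym_inv_iff id_partition_in_partitions[OF assms] block_edges_id_partition[OF assms])

text \<open>
  An idempotent \<open>\<alpha>\<close> all of whose blocks are transversals joins each \<open>y\<close> to \<open>y'\<close>: there are a block
  containing some \<open>x\<close> and \<open>y'\<close>, and a block containing \<open>y\<close> and some \<open>z'\<close>; passing through
  the middle copy of \<open>y\<close> puts \<open>x\<close> and \<open>z'\<close> into one block of \<open>\<alpha>\<alpha> = \<alpha>\<close>, so all four vertices are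
  in the same block.  Thus \<open>\<alpha>\<close> is determined by its kernel \<open>\<epsilon>\<close> and equals \<open>id\<^sub>\<epsilon>\<close>.
\<close>

lemma dual_sym_inv_idems_eq: "dual_sym_inv_idems X = id_partition X ` {\<epsilon>. equiv X \<epsilon>}"
proof (intro subset_antisym subsetI)
  fix \<alpha> assume "\<alpha> \<in> id_partition X ` {\<epsilon>. equiv X \<epsilon>}"
  then obtain \<epsilon> where \<epsilon>: "equiv X \<epsilon>" and \<alpha>: "\<alpha> = id_partition X \<epsilon>" by blast
  note part = id_partition_in_partitions[OF \<epsilon>]
  have "map_prod Inr Inr ` \<epsilon> \<subseteq> block_edges (id_partition X \<epsilon>)"
    by (auto simp: block_edges_id_partition[OF \<epsilon>])
  then have "path_rel X \<alpha> \<alpha> = block_edges \<alpha>"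
    unfolding \<alpha> path_rel_id_partition_right[OF part \<epsilon>] by (rule join_absorb[OF equiv_block_edges[OF part]])
  then have "partition_product X \<alpha> \<alpha> = \<alpha>"
    using part by (simp add: \<alpha> partition_product_eq_quotient quotient_block_edges)
  then show "\<alpha> \<in> dual_sym_inv_idems X"
    using id_partition_in_dual_sym_inv[OF \<epsilon>]
    by (simp add: dual_sym_inv_idems_def idempotents_def partition_monoid_def \<alpha>)
next
  fix \<alpha> assume "\<alpha> \<in> dual_sym_inv_idems X"
  then have J: "\<alpha> \<in> dual_sym_inv X" and idem: "partition_product X \<alpha> \<alpha> = \<alpha>"
    by (auto simp: dual_sym_inv_idems_def idempotents_def partition_monoid_def)
  from J have part: "\<alpha> \<in> partitions X"
    and up: "\<And>x. x \<in> X \<Longrightarrow> \<exists>y\<in>X. (Inl x, Inr y) \<in> block_edges \<alpha>"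
    and down: "\<And>y. y \<in> X \<Longrightarrow> \<exists>x\<in>X. (Inl x, Inr y) \<in> block_edges \<alpha>"
    by (auto simp: dual_sym_inv_iff)
  note R = equivD[OF equiv_block_edges[OF part]]
  have path: "path_rel X \<alpha> \<alpha> = block_edges \<alpha>"
    using block_edges_partition_product[of X \<alpha> \<alpha>] idem by simp
  have diag: "(Inl y, Inr y) \<in> block_edges \<alpha>" if y: "y \<in> X" for y
  proof -
    obtain x where x: "x \<in> X" "(Inl x, Inr y) \<in> block_edges \<alpha>" using down y by blast
    obtain z where z: "z \<in> X" "(Inl y, Inr z) \<in> block_edges \<alpha>" using up y by blast
    have "(Inl x, Inr z) \<in> block_edges \<alpha>"
      using path_rel_through_middle[OF x(2) z(2) x(1) z(1)] path by simp
    then have "(Inr z, Inr y) \<in> block_edges \<alpha>" using x(2) by (blast intro: R(4,5))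
    with z(2) show ?thesis by (rule R(5))
  qed
  define \<epsilon> where "\<epsilon> = pker X \<alpha>"
  have \<epsilon>: "equiv X \<epsilon>"
  proof (rule equivI')
    show "(x, z) \<in> \<epsilon>" if "(x, y) \<in> \<epsilon>" "(y, z) \<in> \<epsilon>" for x y z
      using that R(5)[of "Inl x" "Inl y" "Inl z"] by (simp add: \<epsilon>_def pker_iff)
  qed (auto simp: \<epsilon>_def pker_iff intro: R(3,4))
  have to_upper: "(p, Inl (case_sum id id p)) \<in> block_edges \<alpha>" if "p \<in> X <+> X" for p
    using that by (auto intro: R(3) R(4)[OF diag])
  have "(p, q) \<in> block_edges \<alpha> \<longleftrightarrow> (case_sum id id p, case_sum id id q) \<in> \<epsilon>" for p q
  proof (cases "p \<in> X <+> X \<and> q \<in> X <+> X")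
    case True
    then have "(p, q) \<in> block_edges \<alpha> \<longleftrightarrow>
        (Inl (case_sum id id p), Inl (case_sum id id q)) \<in> block_edges \<alpha>"
      using to_upper[of p] to_upper[of q] by (blast intro: R(4,5))
    with True show ?thesis by (auto simp: \<epsilon>_def pker_iff)
  next
    case False
    then show ?thesis using R(1,2) by (auto simp: \<epsilon>_def pker_iff split: sum.splits)
  qed
  then have "block_edges \<alpha> = block_edges (id_partition X \<epsilon>)"
    unfolding block_edges_id_partition[OF \<epsilon>] by auto
  then have "\<alpha> = id_partition X \<epsilon>"
    by (rule partition_eqI[OF part id_partition_in_partitions[OF \<epsilon>]])
  then show "\<alpha> \<in> id_partition X ` {\<epsilon>. equiv X \<epsilon>}" using \<epsilon> by blast
qed

section \<open>The right and left restriction subsemigroups\<close>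

lemma product_id_commute_iff:
  assumes "\<alpha> \<in> partitions X" and "equiv X \<epsilon>" and "equiv X \<eta>"
  shows "partition_product X (id_partition X \<epsilon>) \<alpha> = partition_product X \<alpha> (id_partition X \<eta>) \<longleftrightarrow>
    (block_edges \<alpha> \<union> map_prod Inl Inl ` \<epsilon>)\<^sup>+ = (block_edges \<alpha> \<union> map_prod Inr Inr ` \<eta>)\<^sup>+"
proof -
  have "partition_product X \<beta> \<gamma> = partition_product X \<beta>' \<gamma>' \<longleftrightarrow> path_rel X \<beta> \<gamma> = path_rel X \<beta>' \<gamma>'"
    for \<beta> \<gamma> \<beta>' \<gamma>'
    by (metis block_edges_partition_product partition_product_eq_quotient)
  then show ?thesis
    using assms by (simp add: path_rel_id_partition_left path_rel_id_partition_right)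
qed

lemma Rest_R_eq:
  "Rest_R (partition_monoid X) (dual_sym_inv_idems X) =
     {\<alpha> \<in> partitions X. pdom X \<alpha> = X \<or> pker X \<alpha> = X \<times> X}"
proof -
  let ?E = "{\<epsilon>. equiv X \<epsilon>}"
  have "\<alpha> \<in> Rest_R (partition_monoid X) (dual_sym_inv_idems X) \<longleftrightarrow> pdom X \<alpha> = X \<or> pker X \<alpha> = X \<times> X"
    if \<alpha>: "\<alpha> \<in> partitions X" for \<alpha>
  proof -
    let ?R = "block_edges \<alpha>"
    have "\<alpha> \<in> Rest_R (partition_monoid X) (dual_sym_inv_idems X) \<longleftrightarrow>
        (\<forall>\<epsilon>\<in>?E. \<exists>\<eta>\<in>?E. partition_product X (id_partition X \<epsilon>) \<alpha> = partition_product X \<alpha> (id_partition X \<eta>))"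
      using \<alpha> by (auto simp: Rest_R_def r_coset_def l_coset_def dual_sym_inv_idems_eq partition_monoid_def)
    also have "\<dots> \<longleftrightarrow> (\<forall>\<epsilon>\<in>?E. \<exists>\<eta>\<in>?E.
        (?R \<union> map_prod Inl Inl ` \<epsilon>)\<^sup>+ = (?R \<union> map_prod Inr Inr ` \<eta>)\<^sup>+)"
      by (intro ball_cong bex_cong refl product_id_commute_iff[OF \<alpha>]) simp_all
    also have "\<dots> \<longleftrightarrow> (\<forall>\<rho>\<in>{\<rho>. equiv (Inl ` X) \<rho>}. \<exists>\<sigma>\<in>{\<sigma>. equiv (Inr ` X) \<sigma>}. (?R \<union> \<rho>)\<^sup>+ = (?R \<union> \<sigma>)\<^sup>+)"
      unfolding equivs_on_inj_image[OF inj_Inl] equivs_on_inj_image[OF inj_Inr] by simp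
    also have "\<dots> \<longleftrightarrow> (\<forall>a\<in>Inl ` X. \<exists>b\<in>Inr ` X. (a, b) \<in> ?R) \<or> Inl ` X \<times> Inl ` X \<subseteq> ?R"
    proof -
      have "equiv (Inl ` X \<union> Inr ` X) ?R" and "Inl ` X \<inter> Inr ` X = {}"
        using equiv_block_edges[OF \<alpha>] by (auto simp: Plus_def)
      from join_exchange_iff[OF this] show ?thesis by simp
    qed
    also have "\<dots> \<longleftrightarrow> (\<forall>x\<in>X. \<exists>y\<in>X. (Inl x, Inr y) \<in> ?R) \<or> (\<forall>x\<in>X. \<forall>y\<in>X. (Inl x, Inl y) \<in> ?R)"
      by auto
    also have "\<dots> \<longleftrightarrow> pdom X \<alpha> = X \<or> pker X \<alpha> = X \<times> X"
      by (auto simp: set_eq_iff pdom_iff pker_iff)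
    finally show ?thesis .
  qed
  then show ?thesis by (auto simp: Rest_R_def partition_monoid_def)
qed

lemma Rest_L_eq:
  "Rest_L (partition_monoid X) (dual_sym_inv_idems X) =
     {\<alpha> \<in> partitions X. pcodom X \<alpha> = X \<or> pcoker X \<alpha> = X \<times> X}"
proof -
  let ?E = "{\<epsilon>. equiv X \<epsilon>}"
  have "\<alpha> \<in> Rest_L (partition_monoid X) (dual_sym_inv_idems X) \<longleftrightarrow> pcodom X \<alpha> = X \<or> pcoker X \<alpha> = X \<times> X"
    if \<alpha>: "\<alpha> \<in> partitions X" for \<alpha>
  proof -
    let ?R = "block_edges \<alpha>"
    have flip: "(Inr y, Inl x) \<in> ?R \<longleftrightarrow> (Inl x, Inr y) \<in> ?R" for x y
      using equivD(4)[OF equiv_block_edges[OF \<alpha>]] by blast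
    have "\<alpha> \<in> Rest_L (partition_monoid X) (dual_sym_inv_idems X) \<longleftrightarrow>
        (\<forall>\<epsilon>\<in>?E. \<exists>\<eta>\<in>?E. partition_product X \<alpha> (id_partition X \<epsilon>) = partition_product X (id_partition X \<eta>) \<alpha>)"
      using \<alpha> by (auto simp: Rest_L_def r_coset_def l_coset_def dual_sym_inv_idems_eq partition_monoid_def)
    also have "\<dots> \<longleftrightarrow> (\<forall>\<epsilon>\<in>?E. \<exists>\<eta>\<in>?E.
        (?R \<union> map_prod Inr Inr ` \<epsilon>)\<^sup>+ = (?R \<union> map_prod Inl Inl ` \<eta>)\<^sup>+)"
      by (intro ball_cong bex_cong refl) (metis mem_Collect_eq product_id_commute_iff[OF \<alpha>])
    also have "\<dots> \<longleftrightarrow> (\<forall>\<rho>\<in>{\<rho>. equiv (Inr ` X) \<rho>}. \<exists>\<sigma>\<in>{\<sigma>. equiv (Inl ` X) \<sigma>}. (?R \<union> \<rho>)\<^sup>+ = (?R \<union> \<sigma>)\<^sup>+)"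
      unfolding equivs_on_inj_image[OF inj_Inl] equivs_on_inj_image[OF inj_Inr] by simp
    also have "\<dots> \<longleftrightarrow> (\<forall>a\<in>Inr ` X. \<exists>b\<in>Inl ` X. (a, b) \<in> ?R) \<or> Inr ` X \<times> Inr ` X \<subseteq> ?R"
    proof -
      have "equiv (Inr ` X \<union> Inl ` X) ?R" and "Inr ` X \<inter> Inl ` X = {}"
        using equiv_block_edges[OF \<alpha>] by (auto simp: Plus_def Un_commute)
      from join_exchange_iff[OF this] show ?thesis by simp
    qed
    also have "\<dots> \<longleftrightarrow> (\<forall>x\<in>X. \<exists>y\<in>X. (Inl y, Inr x) \<in> ?R) \<or> (\<forall>x\<in>X. \<forall>y\<in>X. (Inr x, Inr y) \<in> ?R)"
      using flip by auto
    also have "\<dots> \<longleftrightarrow> pcodom X \<alpha> = X \<or> pcoker X \<alpha> = X \<times> X"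
      by (auto simp: set_eq_iff pcodom_iff pcoker_iff)
    finally show ?thesis .
  qed
  then show ?thesis by (auto simp: Rest_L_def partition_monoid_def)
qed

section \<open>The two-sided restriction subsemigroup\<close>

text \<open>If all upper vertices are in one block, they are either all in a transversal or none of them is.\<close>

lemma pdom_empty_if_pker_full:
  assumes "\<alpha> \<in> partitions X" and "pker X \<alpha> = X \<times> X" and "pdom X \<alpha> \<noteq> X"
  shows "pdom X \<alpha> = {}"
  using assms pdom_iff[of _ X \<alpha>] pker_iff[of _ _ X \<alpha>] equivD(5)[OF equiv_block_edges[OF assms(1)]]
  by (auto; blast)

lemma pcodom_empty_if_pcoker_full:
  assumes "\<alpha> \<in> partitions X" and "pcoker X \<alpha> = X \<times> X" and "pcodom X \<alpha> \<noteq> X"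
  shows "pcodom X \<alpha> = {}"
  using assms pcodom_iff[of _ X \<alpha>] pcoker_iff[of _ _ X \<alpha>] equivD(5)[OF equiv_block_edges[OF assms(1)]]
  by (auto; blast)

lemma zeta_in_partitions: "zeta X \<in> partitions X"
  unfolding partitions_def zeta_def partition_on_def disjoint_def by auto

lemma block_edges_zeta: "block_edges (zeta X) = Inl ` X \<times> Inl ` X \<union> Inr ` X \<times> Inr ` X"
  unfolding block_edges_def zeta_def by auto

lemma zeta_iff:
  "\<alpha> \<in> partitions X \<and> pdom X \<alpha> = {} \<and> pcodom X \<alpha> = {} \<and>
     pker X \<alpha> = X \<times> X \<and> pcoker X \<alpha> = X \<times> X \<longleftrightarrow> \<alpha> = zeta X" (is "?P \<alpha> \<longleftrightarrow> _")
proof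
  assume P: "?P \<alpha>"
  then have \<alpha>: "\<alpha> \<in> partitions X" by simp
  note R = equivD[OF equiv_block_edges[OF \<alpha>]]
  have "block_edges \<alpha> = block_edges (zeta X)"
  proof (intro subset_antisym subrelI)
    fix p q assume pq: "(p, q) \<in> block_edges \<alpha>"
    show "(p, q) \<in> block_edges (zeta X)"
      using pq R(1,2,4)[OF pq] P pdom_iff[of _ X \<alpha>] unfolding block_edges_zeta by auto
  next
    fix p q assume "(p, q) \<in> block_edges (zeta X)"
    then show "(p, q) \<in> block_edges \<alpha>"
      using P pker_iff[of _ _ X \<alpha>] pcoker_iff[of _ _ X \<alpha>] unfolding block_edges_zeta by auto
  qed
  then show "\<alpha> = zeta X" by (rule partition_eqI[OF \<alpha> zeta_in_partitions])
next
  assume "\<alpha> = zeta X"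
  moreover have "pdom X (zeta X) = {}" "pcodom X (zeta X) = {}"
    using pdom_iff[of _ X "zeta X"] pcodom_iff[of _ X "zeta X"]
    by (auto simp: block_edges_zeta)
  moreover have "pker X (zeta X) = X \<times> X" "pcoker X (zeta X) = X \<times> X"
    by (auto simp: pker_iff pcoker_iff block_edges_zeta)
  ultimately show "?P \<alpha>" using zeta_in_partitions by blast
qed

lemma Rest_eq_inter: "Rest S E = Rest_L S E \<inter> Rest_R S E"
  by (auto simp: Rest_def Rest_L_def Rest_R_def)

lemma pdom_empty_iff_pcodom_empty:
  "pdom X \<alpha> = {} \<longleftrightarrow> pcodom X \<alpha> = {}"
  using pdom_iff[of _ X \<alpha>] pcodom_iff[of _ X \<alpha>] by blast

text \<open>
  In the mixed case, say \<open>pdom X \<alpha> = X\<close> while the lower row is a single block and \<open>pcodom X \<alpha> = {}\<close>,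
  there is no transversal at all; this forces \<open>X = {}\<close>, and then \<open>\<alpha>\<close> lies in \<open>dual_sym_inv X\<close>.
\<close>

lemma Rest_eq:
  "Rest (partition_monoid X) (dual_sym_inv_idems X) = dual_sym_inv X \<union> {zeta X}"
proof (intro subset_antisym subsetI)
  fix \<alpha> assume "\<alpha> \<in> Rest (partition_monoid X) (dual_sym_inv_idems X)"
  then have \<alpha>: "\<alpha> \<in> partitions X"
    and "pdom X \<alpha> = X \<or> pker X \<alpha> = X \<times> X" "pcodom X \<alpha> = X \<or> pcoker X \<alpha> = X \<times> X"
    unfolding Rest_eq_inter Rest_R_eq Rest_L_eq by auto
  then show "\<alpha> \<in> dual_sym_inv X \<union> {zeta X}"
    using pdom_empty_if_pker_full[OF \<alpha>] pcodom_empty_if_pcoker_full[OF \<alpha>]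
      pdom_empty_iff_pcodom_empty[of X \<alpha>] zeta_iff[of \<alpha> X]
    unfolding dual_sym_inv_def by blast
next
  fix \<alpha> assume "\<alpha> \<in> dual_sym_inv X \<union> {zeta X}"
  then show "\<alpha> \<in> Rest (partition_monoid X) (dual_sym_inv_idems X)"
    using zeta_iff[of \<alpha> X] unfolding Rest_eq_inter Rest_R_eq Rest_L_eq dual_sym_inv_def by blast
qed

lemma submonoid_dual_sym_inv: "submonoid (dual_sym_inv X) (partition_monoid X)"
proof (rule submonoid.intro)
  show "dual_sym_inv X \<subseteq> carrier (partition_monoid X)"
    by (auto simp: dual_sym_inv_def partition_monoid_def)
next
  have "equiv X (Id_on X)" by (rule equivI') auto
  moreover have "X // Id_on X = (\<lambda>x. {x}) ` X" by (auto simp: quotient_def)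
  then have "id_partition X (Id_on X) = (\<lambda>x. {Inl x, Inr x}) ` X"
    by (simp add: id_partition_def image_image Plus_def insert_commute)
  ultimately show "\<one>\<^bsub>partition_monoid X\<^esub> \<in> dual_sym_inv X"
    using id_partition_in_dual_sym_inv[of X "Id_on X"] by (simp add: partition_monoid_def)
next
  fix \<alpha> \<beta> assume J: "\<alpha> \<in> dual_sym_inv X" "\<beta> \<in> dual_sym_inv X"
  have "\<exists>z\<in>X. (Inl x, Inr z) \<in> path_rel X \<alpha> \<beta>" if x: "x \<in> X" for x
  proof -
    obtain y where "y \<in> X" "(Inl x, Inr y) \<in> block_edges \<alpha>"
      using J(1) x by (auto simp: dual_sym_inv_iff)
    moreover from this obtain z where "z \<in> X" "(Inl y, Inr z) \<in> block_edges \<beta>"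
      using J(2) by (auto simp: dual_sym_inv_iff)
    ultimately show ?thesis using path_rel_through_middle x by metis
  qed
  moreover have "\<exists>x\<in>X. (Inl x, Inr z) \<in> path_rel X \<alpha> \<beta>" if z: "z \<in> X" for z
  proof -
    obtain y where "y \<in> X" "(Inl y, Inr z) \<in> block_edges \<beta>"
      using J(2) z by (auto simp: dual_sym_inv_iff)
    moreover from this obtain x where "x \<in> X" "(Inl x, Inr y) \<in> block_edges \<alpha>"
      using J(1) by (auto simp: dual_sym_inv_iff)
    ultimately show ?thesis using path_rel_through_middle z by metis
  qed
  ultimately show "\<alpha> \<otimes>\<^bsub>partition_monoid X\<^esub> \<beta> \<in> dual_sym_inv X"
    by (simp add: partition_monoid_def dual_sym_inv_iff partition_product_in_partitions
        block_edges_partition_product)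
qed

section \<open>The zero element\<close>

text \<open>
  The middle row of the product graph is connected, being the upper block of \<open>zeta X\<close>.  If every upper
  vertex is joined to it, or the upper row is itself one block, the upper row stays connected.  No path
  leads to the lower row because \<open>zeta X\<close> has no transversal.
\<close>

lemma product_zeta_right:
  assumes \<alpha>: "\<alpha> \<in> partitions X" and full: "pdom X \<alpha> = X \<or> pker X \<alpha> = X \<times> X"
  shows "partition_product X \<alpha> (zeta X) = zeta X"
proof -
  let ?G = "product_graph \<alpha> (zeta X)"
  have middle: "(Middle x, Middle y) \<in> ?G" if "x \<in> X" "y \<in> X" for x y
    using that product_graph_right[of "Inl x" "Inl y" "zeta X" \<alpha>] by (simp add: block_edges_zeta)
  have lower: "(Lower x, Lower y) \<in> ?G\<^sup>*" if "x \<in> X" "y \<in> X" for x y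
    using that product_graph_right[of "Inr x" "Inr y" "zeta X" \<alpha>] by (simp add: block_edges_zeta)
  have upper: "(Upper x, Upper y) \<in> ?G\<^sup>*" if xy: "x \<in> X" "y \<in> X" for x y
  proof (cases "pdom X \<alpha> = X")
    case True
    then obtain x' y' where "x' \<in> X" "(Inl x, Inr x') \<in> block_edges \<alpha>"
      "y' \<in> X" "(Inl y, Inr y') \<in> block_edges \<alpha>"
      using xy pdom_iff[of _ X \<alpha>] by metis
    then have "(Upper x, Middle x') \<in> ?G" "(Middle x', Middle y') \<in> ?G" "(Middle y', Upper y) \<in> ?G"
      using middle product_graph_left[of "Inl x" "Inr x'" \<alpha> "zeta X"]
        symD[OF sym_product_graph product_graph_left[of "Inl y" "Inr y'" \<alpha> "zeta X"]] by simp_all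
    then show ?thesis by (meson r_into_rtrancl rtrancl_trans)
  next
    case False
    then have "(Inl x, Inl y) \<in> block_edges \<alpha>" using full xy pker_iff[of x y X \<alpha>] by auto
    from product_graph_left[OF this, of "zeta X"] show ?thesis by simp
  qed
  have closed: "?G `` (range Upper \<union> range Middle) \<subseteq> range Upper \<union> range Middle"
  proof
    fix v assume "v \<in> ?G `` (range Upper \<union> range Middle)"
    then obtain u where "(u, v) \<in> ?G" "u \<in> range Upper \<union> range Middle" by blast
    then show "v \<in> range Upper \<union> range Middle"
      by (cases rule: product_graph_cases) (auto simp: block_edges_zeta split: sum.splits)
  qed
  have cut: "(Upper x, Lower y) \<notin> ?G\<^sup>*" for x y
    using rtrancl_invariant[OF _ _ closed, of "Upper x" "Lower y"] by auto
  then have cut': "(Lower y, Upper x) \<notin> ?G\<^sup>*" for x y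
    using symD[OF sym_rtrancl[OF sym_product_graph]] by metis
  have "path_rel X \<alpha> (zeta X) = block_edges (zeta X)"
    by (auto simp: path_rel_def block_edges_zeta cut cut' intro: upper lower)
  then show ?thesis
    by (simp add: partition_product_eq_quotient quotient_block_edges zeta_in_partitions)
qed

lemma product_zeta_left:
  assumes \<alpha>: "\<alpha> \<in> partitions X" and full: "pcodom X \<alpha> = X \<or> pcoker X \<alpha> = X \<times> X"
  shows "partition_product X (zeta X) \<alpha> = zeta X"
proof -
  let ?G = "product_graph (zeta X) \<alpha>"
  have middle: "(Middle x, Middle y) \<in> ?G" if "x \<in> X" "y \<in> X" for x y
    using that product_graph_left[of "Inr x" "Inr y" "zeta X" \<alpha>] by (simp add: block_edges_zeta)
  have upper: "(Upper x, Upper y) \<in> ?G\<^sup>*" if "x \<in> X" "y \<in> X" for x y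
    using that product_graph_left[of "Inl x" "Inl y" "zeta X" \<alpha>] by (simp add: block_edges_zeta)
  have lower: "(Lower x, Lower y) \<in> ?G\<^sup>*" if xy: "x \<in> X" "y \<in> X" for x y
  proof (cases "pcodom X \<alpha> = X")
    case True
    then obtain x' y' where "x' \<in> X" "(Inl x', Inr x) \<in> block_edges \<alpha>"
      "y' \<in> X" "(Inl y', Inr y) \<in> block_edges \<alpha>"
      using xy pcodom_iff[of _ X \<alpha>] by metis
    then have "(Lower x, Middle x') \<in> ?G" "(Middle x', Middle y') \<in> ?G" "(Middle y', Lower y) \<in> ?G"
      using middle product_graph_right[of "Inl y'" "Inr y" \<alpha> "zeta X"]
        symD[OF sym_product_graph product_graph_right[of "Inl x'" "Inr x" \<alpha> "zeta X"]] by simp_all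
    then show ?thesis by (meson r_into_rtrancl rtrancl_trans)
  next
    case False
    then have "(Inr x, Inr y) \<in> block_edges \<alpha>" using full xy pcoker_iff[of x y X \<alpha>] by auto
    from product_graph_right[OF this, of "zeta X"] show ?thesis by simp
  qed
  have closed: "?G `` range Upper \<subseteq> range Upper"
  proof
    fix v assume "v \<in> ?G `` range Upper"
    then obtain u where "(u, v) \<in> ?G" "u \<in> range Upper" by blast
    then show "v \<in> range Upper"
      by (cases rule: product_graph_cases) (auto simp: block_edges_zeta split: sum.splits)
  qed
  have cut: "(Upper x, Lower y) \<notin> ?G\<^sup>*" for x y
    using rtrancl_invariant[OF _ _ closed, of "Upper x" "Lower y"] by auto
  then have cut': "(Lower y, Upper x) \<notin> ?G\<^sup>*" for x y
    using symD[OF sym_rtrancl[OF sym_product_graph]] by metis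
  have "path_rel X (zeta X) \<alpha> = block_edges (zeta X)"
    by (auto simp: path_rel_def block_edges_zeta cut cut' intro: upper lower)
  then show ?thesis
    by (simp add: partition_product_eq_quotient quotient_block_edges zeta_in_partitions)
qed

lemma is_zero_on_zeta: "is_zero_on (partition_monoid X) (dual_sym_inv X \<union> {zeta X}) (zeta X)"
  unfolding is_zero_on_def
proof (intro conjI ballI)
  fix \<alpha> assume "\<alpha> \<in> dual_sym_inv X \<union> {zeta X}"
  then have \<alpha>: "\<alpha> \<in> partitions X" and "pdom X \<alpha> = X \<or> pker X \<alpha> = X \<times> X"
    and "pcodom X \<alpha> = X \<or> pcoker X \<alpha> = X \<times> X"
    using zeta_iff[of \<alpha> X] by (auto simp: dual_sym_inv_def)
  then show "\<alpha> \<otimes>\<^bsub>partition_monoid X\<^esub> zeta X = zeta X" "zeta X \<otimes>\<^bsub>partition_monoid X\<^esub> \<alpha> = zeta X"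
    using product_zeta_right[OF \<alpha>] product_zeta_left[OF \<alpha>] by (simp_all add: partition_monoid_def)
qed simp

theorem proposition4p16:
  fixes X :: "'a set"
  shows
    "(\<forall>\<alpha>. \<alpha> \<in> partitions X \<and> pdom X \<alpha> = {} \<and> pcodom X \<alpha> = {} \<and>
          pker X \<alpha> = X \<times> X \<and> pcoker X \<alpha> = X \<times> X \<longleftrightarrow> \<alpha> = zeta X)

     \<and> Rest_R (partition_monoid X) (dual_sym_inv_idems X) =
         {\<alpha> \<in> partitions X. pdom X \<alpha> = X \<or> pker X \<alpha> = X \<times> X}
     \<and> {\<alpha> \<in> partitions X. pdom X \<alpha> = X \<or> pker X \<alpha> = X \<times> X} =
         {\<alpha> \<in> partitions X. pdom X \<alpha> = X} \<union>
         {\<alpha> \<in> partitions X. pdom X \<alpha> = {} \<and> pker X \<alpha> = X \<times> X}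
     \<and> (X \<noteq> {} \<longrightarrow>
         disjnt {\<alpha> \<in> partitions X. pdom X \<alpha> = X}
                {\<alpha> \<in> partitions X. pdom X \<alpha> = {} \<and> pker X \<alpha> = X \<times> X})

     \<and> Rest_L (partition_monoid X) (dual_sym_inv_idems X) =
         {\<alpha> \<in> partitions X. pcodom X \<alpha> = X \<or> pcoker X \<alpha> = X \<times> X}
     \<and> {\<alpha> \<in> partitions X. pcodom X \<alpha> = X \<or> pcoker X \<alpha> = X \<times> X} =
         {\<alpha> \<in> partitions X. pcodom X \<alpha> = X} \<union>
         {\<alpha> \<in> partitions X. pcodom X \<alpha> = {} \<and> pcoker X \<alpha> = X \<times> X}
     \<and> (X \<noteq> {} \<longrightarrow>
         disjnt {\<alpha> \<in> partitions X. pcodom X \<alpha> = X}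
                {\<alpha> \<in> partitions X. pcodom X \<alpha> = {} \<and> pcoker X \<alpha> = X \<times> X})

     \<and> Rest (partition_monoid X) (dual_sym_inv_idems X) = dual_sym_inv X \<union> {zeta X}
     \<and> submonoid (dual_sym_inv X) (partition_monoid X)
     \<and> (X \<noteq> {} \<longrightarrow> zeta X \<notin> dual_sym_inv X)
     \<and> is_zero_on (partition_monoid X) (dual_sym_inv X \<union> {zeta X}) (zeta X)"
proof (intro conjI)
  show "\<forall>\<alpha>. \<alpha> \<in> partitions X \<and> pdom X \<alpha> = {} \<and> pcodom X \<alpha> = {} \<and>
      pker X \<alpha> = X \<times> X \<and> pcoker X \<alpha> = X \<times> X \<longleftrightarrow> \<alpha> = zeta X"
    by (intro allI zeta_iff)
  show "{\<alpha> \<in> partitions X. pdom X \<alpha> = X \<or> pker X \<alpha> = X \<times> X} =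
      {\<alpha> \<in> partitions X. pdom X \<alpha> = X} \<union> {\<alpha> \<in> partitions X. pdom X \<alpha> = {} \<and> pker X \<alpha> = X \<times> X}"
    using pdom_empty_if_pker_full[of _ X] by auto
  show "{\<alpha> \<in> partitions X. pcodom X \<alpha> = X \<or> pcoker X \<alpha> = X \<times> X} =
      {\<alpha> \<in> partitions X. pcodom X \<alpha> = X} \<union> {\<alpha> \<in> partitions X. pcodom X \<alpha> = {} \<and> pcoker X \<alpha> = X \<times> X}"
    using pcodom_empty_if_pcoker_full[of _ X] by auto
  show "X \<noteq> {} \<longrightarrow> zeta X \<notin> dual_sym_inv X"
    using zeta_iff[of "zeta X" X] by (auto simp: dual_sym_inv_def)
  show "X \<noteq> {} \<longrightarrow>
      disjnt {\<alpha> \<in> partitions X. pdom X \<alpha> = X}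
             {\<alpha> \<in> partitions X. pdom X \<alpha> = {} \<and> pker X \<alpha> = X \<times> X}"
    by (auto simp: disjnt_iff)
  show "X \<noteq> {} \<longrightarrow>
      disjnt {\<alpha> \<in> partitions X. pcodom X \<alpha> = X}
             {\<alpha> \<in> partitions X. pcodom X \<alpha> = {} \<and> pcoker X \<alpha> = X \<times> X}"
    by (auto simp: disjnt_iff)
qed (fact Rest_R_eq Rest_L_eq Rest_eq submonoid_dual_sym_inv is_zero_on_zeta)+

end
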